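(* Let $f:\mathbb{Z}^+\times\mathbb{Z}^+\to\mathbb{Z}^+$ be such that $f(\cdot,q)$ is concave for each $q\in\mathbb{Z}^+$. Then, for any $q\in\mathbb{Z}^+$, $$\sum_{n=1}^{\infty}\frac{1}{q^{f(n,q)}\,n!}$$ is irrational.
   Context: $\mathbb{Z}^+=\{1,2,3,\dots\}$. Here "$f(\cdot,q)$ is concave" means, in this paper's terminology, that $f(x+y,q)\ge f(x,q)+f(y,q)$ for all $x,y\in\mathbb{Z}^+$. *)

theory Defs
  imports Complex_Main
begin

text \<open>
  A positive integer is a natural number that is at least 1; values of functions at 0 are ignored.
  "Concave" here means superadditive on the positive integers. It is not the usual notion of
  concavity (\<open>concave_on\<close> in HOL-Analysis).
\<close>

definition concave_pos :: "(nat \<Rightarrow> nat) \<Rightarrow> bool" where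
  "concave_pos g \<longleftrightarrow> (\<forall>x\<ge>1. \<forall>y\<ge>1. g (x + y) \<ge> g x + g y)"

end

theory Submission
  imports Defs
begin

text \<open>
  This is Fourier's argument for the irrationality of e. Superadditivity makes
  \<open>g = f(\<cdot>, q)\<close> increasing, so \<open>q\<^bsup>g(N)\<^esup> N!\<close> clears the denominators of
  the first \<open>N\<close> terms, while the tail multiplied by it is positive and at most
  \<open>(N+1)\<^bsup>-1\<^esup> + (N+1)\<^bsup>-2\<^esup> + \<dots> = 1/N\<close>.
\<close>

text \<open>If the sum were \<open>p / b\<close>, then \<open>b * d N\<close> times the tail after
  index \<open>N\<close> would be an integer for every \<open>N\<close>. It is positive because all
  terms are, yet smaller than 1 for large \<open>N\<close>.\<close>

lemma suminf_irrational_if_small_scaled_tails: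
  fixes a :: "nat \<Rightarrow> real" and d :: "nat \<Rightarrow> int"
  assumes summable: "summable a"
    and pos: "\<And>n. a n > 0"
    and d_pos: "\<And>N. d N > 0"
    and partial: "\<And>N. of_int (d N) * (\<Sum>n\<le>N. a n) \<in> \<int>"
    and tail: "(\<lambda>N. of_int (d N) * (\<Sum>n. a (n + Suc N))) \<longlonglongrightarrow> 0"
  shows "suminf a \<notin> \<rat>"
proof
  assume "suminf a \<in> \<rat>"
  then obtain p b :: int where b: "b > 0" and eq: "suminf a = of_int p / of_int b"
    by (elim Rats_cases') auto
  have "\<forall>\<^sub>F N in sequentially. of_int (d N) * (\<Sum>n. a (n + Suc N)) < 1 / of_int b"
    using order_tendstoD(2)[OF tail, of "1 / of_int b"] b by simp
  then obtain N where N: "of_int (d N) * (\<Sum>n. a (n + Suc N)) < 1 / of_int b"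
    by (auto simp: eventually_sequentially)
  define x where "x = of_int b * (of_int (d N) * (\<Sum>n. a (n + Suc N)))"
  \<comment> \<open>The tail is the total minus the partial sum: \<open>b\<close> clears the
    denominator of the total and \<open>d N\<close> those of the partial sum, so both products are
    integers.\<close>
  have "x = of_int (d N) * (of_int b * suminf a) - of_int b * (of_int (d N) * (\<Sum>n\<le>N. a n))"
    by (simp add: x_def suminf_split_initial_segment[OF summable, of "Suc N"]
        lessThan_Suc_atMost algebra_simps)
  also have "of_int b * suminf a = of_int p"
    using b eq by simp
  finally have "x \<in> \<int>"
    using partial[of N] by auto
  moreover have "0 < (\<Sum>n. a (n + Suc N))"
    using summable pos by (intro suminf_pos) (simp_all only: summable_iff_shift)
  hence "x > 0"
    using b d_pos[of N] by (simp add: x_def)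
  moreover have "x < 1"
    using N b by (simp add: x_def field_simps)
  ultimately show False
    by (auto elim!: Ints_cases)
qed

text \<open>Apply superadditivity to \<open>m\<close> and \<open>n - m\<close> and drop the summand
  \<open>g (n - m) \<ge> 0\<close>. The case \<open>m = n\<close> is split off because
  superadditivity says nothing about the argument 0.\<close>

lemma concave_pos_mono:
  assumes "concave_pos g" "1 \<le> m" "m \<le> n"
  shows "g m \<le> g n"
proof (cases "m = n")
  case False
  then have "g m + g (n - m) \<le> g (m + (n - m))"
    using assms unfolding concave_pos_def by (metis One_nat_def Suc_leI le_neq_implies_less zero_less_diff)
  then show ?thesis
    using assms by simp
qed simp

text \<open>Each of the \<open>k\<close> factors \<open>N + 1, ..., N + k\<close> that lead from
  \<open>fact N\<close> to \<open>fact (N + k)\<close> is at least \<open>N + 1\<close>.\<close>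

lemma fact_mult_power_le_fact_add:
  "fact N * (N + 1) ^ k \<le> (fact (N + k) :: nat)"
proof (induction k)
  case (Suc k)
  have "fact N * (N + 1) ^ Suc k = (N + 1) * (fact N * (N + 1) ^ k)"
    by (simp only: power_Suc mult_ac)
  also have "\<dots> \<le> (N + k + 1) * fact (N + k)"
    using Suc.IH by (intro mult_mono) auto
  finally show ?case
    by simp
qed simp

theorem corollary61:
  fixes f :: "nat \<Rightarrow> nat \<Rightarrow> nat" and q :: nat
  assumes pos: "\<And>n r. n \<ge> 1 \<Longrightarrow> r \<ge> 1 \<Longrightarrow> f n r \<ge> 1"
    and concave: "\<And>r. r \<ge> 1 \<Longrightarrow> concave_pos (\<lambda>n. f n r)"
    and q: "q \<ge> 1"
  shows "summable (\<lambda>n. 1 / (real q ^ f (Suc n) q * fact (Suc n))) \<and>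
         (\<Sum>n. 1 / (real q ^ f (Suc n) q * fact (Suc n))) \<notin> \<rat>"
proof -
  \<comment> \<open>Indices are shifted by one: \<open>a n\<close> is the term of index
    \<open>n + 1\<close>, and \<open>d N\<close> is the denominator of the last term in the partial
    sum up to \<open>a N\<close>.\<close>
  define a where "a n = 1 / (real q ^ f (Suc n) q * fact (Suc n))" for n
  define d where "d N = q ^ f (Suc N) q * fact (Suc N)" for N
  have mono: "f m q \<le> f n q" if "1 \<le> m" "m \<le> n" for m n
    using concave_pos_mono[OF concave[OF q]] that .
  have a_eq: "a n = 1 / real (d n)" for n
    by (simp only: a_def d_def of_nat_mult of_nat_power of_nat_fact)
  have d_pos: "d N > 0" for N
    using q by (simp add: d_def)
  have d_dvd: "d n dvd d N" if "n \<le> N" for n N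
    unfolding d_def using that mono by (intro mult_dvd_mono le_imp_power_dvd fact_dvd) auto
  have a_pos: "a n > 0" for n
    using d_pos by (simp add: a_eq)
  \<comment> \<open>The power of \<open>q\<close> does not decrease with the index, so only the
    growth of the factorial counts; \<open>N + 2\<close> is the first new factor after
    \<open>fact (Suc N)\<close>. The case \<open>N = 0\<close> yields summability, the cases
    \<open>k \<ge> 1\<close> the tail bound.\<close>
  have scaled_le: "real (d N) * a (k + N) \<le> (1 / (real N + 2)) ^ k" for N k
  proof -
    have "d N * (N + 2) ^ k = q ^ f (Suc N) q * (fact (Suc N) * (Suc N + 1) ^ k)"
      by (simp add: d_def)
    also have "\<dots> \<le> q ^ f (Suc (k + N)) q * fact (Suc N + k)"
      using q mono by (intro mult_mono power_increasing fact_mult_power_le_fact_add) auto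
    also have "\<dots> = d (k + N)"
      by (simp add: d_def add.commute)
    finally have "real (d N * (N + 2) ^ k) \<le> real (d (k + N))"
      by (rule of_nat_mono)
    then show ?thesis
      using d_pos[of "k + N"] by (simp add: a_eq field_simps)
  qed
  have geo: "summable (\<lambda>k. (1 / (real N + 2)) ^ k)" for N
    by (rule summable_geometric) simp
  have "summable (\<lambda>k. real (d 0) * a k)"
    using scaled_le[of 0] a_pos by (intro summable_comparison_test'[OF geo[of 0]]) (simp add: less_imp_le)
  then have summable: "summable a"
    using d_pos[of 0] by (simp add: summable_cmult_iff)
  have summable_tail: "summable (\<lambda>n. a (n + Suc N))" for N
    using summable by (rule summable_ignore_initial_segment)
  have tail_nonneg: "0 \<le> (\<Sum>n. a (n + Suc N))" for N
    using summable_tail a_pos by (intro suminf_nonneg) (simp_all add: less_imp_le)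
  have tail_le: "real (d N) * (\<Sum>n. a (n + Suc N)) \<le> 1 / real (Suc N)" for N
  proof -
    let ?r = "1 / (real N + 2)"
    have r: "norm ?r < 1"
      by simp
    have "real (d N) * (\<Sum>n. a (n + Suc N)) = (\<Sum>n. real (d N) * a (n + Suc N))"
      using summable_tail by (rule suminf_mult [symmetric])
    \<comment> \<open>The tail starts one index after \<open>N\<close>, so the geometric series
      starts at exponent 1 and its sum is \<open>?r / (1 - ?r)\<close>.\<close>
    also have "\<dots> \<le> (\<Sum>n. ?r * ?r ^ n)"
    proof (rule suminf_le)
      show "real (d N) * a (n + Suc N) \<le> ?r * ?r ^ n" for n
        using scaled_le[of N "Suc n"] by simp
      show "summable (\<lambda>n. real (d N) * a (n + Suc N))"
        using summable_tail by (rule summable_mult)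
      show "summable (\<lambda>n. ?r * ?r ^ n)"
        using geo by (rule summable_mult)
    qed
    also have "\<dots> = ?r * (1 / (1 - ?r))"
      by (simp only: suminf_mult[OF geo] suminf_geometric[OF r])
    also have "\<dots> = 1 / real (Suc N)"
      by (simp add: field_simps)
    finally show ?thesis .
  qed
  have "suminf a \<notin> \<rat>"
  proof (rule suminf_irrational_if_small_scaled_tails[where d = "\<lambda>N. int (d N)"])
    show "of_int (int (d N)) * (\<Sum>n\<le>N. a n) \<in> \<int>" for N
    proof -
      \<comment> \<open>Since \<open>d n\<close> divides \<open>d N\<close>, the product is the
        integer quotient \<open>d N / d n\<close>.\<close>
      have "real (d N) * a n \<in> \<int>" if "n \<le> N" for n
        using d_dvd[OF that] d_pos[of n] by (auto simp: a_eq elim!: dvdE)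
      then show ?thesis
        by (auto simp: sum_distrib_left intro!: Ints_sum)
    qed
    show "(\<lambda>N. of_int (int (d N)) * (\<Sum>n. a (n + Suc N))) \<longlonglongrightarrow> 0"
    proof (rule tendsto_sandwich[where f = "\<lambda>_. 0" and h = "\<lambda>N. 1 / real (Suc N)"])
      show "(\<lambda>N. 1 / real (Suc N)) \<longlonglongrightarrow> 0"
        using LIMSEQ_inverse_real_of_nat by (simp add: inverse_eq_divide)
    qed (use tail_nonneg tail_le in auto)
  qed (use summable a_pos d_pos in auto)
  with summable show ?thesis
    by (simp add: a_def [abs_def])
qed

end
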